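(* Let $P\ge 1$ be an integer, let $t_\circ$ be an integer (the start time step of a job iteration), and for each $p\in\{1,\dots,P\}$ let $r_p(t)\ge 0$, $t\in\{t_\circ,t_\circ+1,\dots\}$, be (an arbitrary realization of) nonnegative random variables. For a family of binary state functions $u=(u_1,\dots,u_P)$, $u_p(t)\in\{0,1\}$, let the execution time $T_{\mathrm{itr}}(u)$ be the smallest integer $T\ge 0$ such that $$\sum_{p=1}^{P}\sum_{t=t_\circ}^{t_\circ+T} r_p(t)\,u_p(t)\ \ge\ 1$$ (with $T_{\mathrm{itr}}(u)=+\infty$ if no such $T$ exists). Then the minimum of $T_{\mathrm{itr}}(u)$ over all choices of binary state functions $u$ is attained when all workers are active throughout the iteration: if $u^*$ satisfies $u^*_p(t)=1$ for every integer $t$ with $t_\circ\le t\le t_\circ+T_{\mathrm{itr}}(u^* )$ and every $p\in\{1,\dots,P\}$, then $T_{\mathrm{itr}}(u^* )\le T_{\mathrm{itr}}(u)$ for every family of binary state functions $u$.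
   Context: A master node distributes one iteration of a computational job among $P$ workers, in discrete time steps. The random variable $r_p(t)$ is the portion of the job iteration that worker $p$ performs at time step $t$ (if active). The state $u_p(t)$ equals $1$ if worker $p$ is active at time step $t$ and $0$ if it is idle. The iteration, started at time step $t_\circ$, finishes as soon as the combined portion of work collected from all workers reaches at least one. The designer is assumed to have full control of the state functions, while $r_p(t)$ does not depend on them; the claim holds regardless of the nature of the random variables $r_p(t)$. *)

theory Defs
  imports "HOL-Probability.Probability" "HOL-Library.Extended_Nat"
begin

definition work_done ::
  "nat \<Rightarrow> int \<Rightarrow> (nat \<Rightarrow> int \<Rightarrow> real) \<Rightarrow> (nat \<Rightarrow> int \<Rightarrow> nat) \<Rightarrow> nat \<Rightarrow> real" where
  "work_done P t0 \<rho> u T = (\<Sum>p=1..P. \<Sum>t=t0..t0 + int T. \<rho> p t * real (u p t))"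

definition exec_time ::
  "nat \<Rightarrow> int \<Rightarrow> (nat \<Rightarrow> int \<Rightarrow> real) \<Rightarrow> (nat \<Rightarrow> int \<Rightarrow> nat) \<Rightarrow> enat" where
  "exec_time P t0 \<rho> u =
     (if \<exists>T. work_done P t0 \<rho> u T \<ge> 1
      then enat (LEAST T. work_done P t0 \<rho> u T \<ge> 1)
      else \<infinity>)"

(* Only workers 1..P and time steps from t0 on occur in the model; values of u elsewhere
   are junk and left unconstrained. *)
definition binary_states :: "nat \<Rightarrow> int \<Rightarrow> (nat \<Rightarrow> int \<Rightarrow> nat) \<Rightarrow> bool" where
  "binary_states P t0 u \<longleftrightarrow> (\<forall>p\<in>{1..P}. \<forall>t\<ge>t0. u p t \<in> {0, 1})"

(* "t0 <= t <= t0 + exec_time", with the upper bound written as t - t0 <= exec_time in enat: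
   it is no restriction if the execution time is infinite. *)
definition active_throughout ::
  "nat \<Rightarrow> int \<Rightarrow> (nat \<Rightarrow> int \<Rightarrow> real) \<Rightarrow> (nat \<Rightarrow> int \<Rightarrow> nat) \<Rightarrow> bool" where
  "active_throughout P t0 \<rho> u \<longleftrightarrow>
     (\<forall>p\<in>{1..P}. \<forall>t\<ge>t0. enat (nat (t - t0)) \<le> exec_time P t0 \<rho> u \<longrightarrow> u p t = 1)"

end

theory Submission
  imports Defs
begin

text \<open>The argument is pathwise, for one fixed outcome \<open>\<omega>\<close>. If
  \<open>u\<close> finished strictly earlier than \<open>ustar\<close>, say after \<open>T\<close>
  steps, then the whole window up to \<open>t0 + T\<close> would lie where \<open>ustar\<close> is
  known to be 1, so \<open>ustar\<close> dominates \<open>u\<close> there. As the portions are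
  nonnegative, \<open>work_done_mono\<close> gives \<open>ustar\<close> at least the work of
  \<open>u\<close>, hence at least 1, by \<open>T\<close>; so \<open>ustar\<close> finishes by
  \<open>T\<close>, a contradiction.\<close>

lemma exec_time_le:
  assumes "work_done P t0 \<rho> u T \<ge> 1"
  shows "exec_time P t0 \<rho> u \<le> enat T"
  using assms by (auto simp: exec_time_def intro: Least_le)

lemma work_done_exec_time:
  assumes "exec_time P t0 \<rho> u = enat T"
  shows "work_done P t0 \<rho> u T \<ge> 1"
  using assms unfolding exec_time_def
  by (auto split: if_splits intro: LeastI)

text \<open>Both hypotheses are confined to the summation window because \<open>ustar\<close> is
  controlled only up to its own execution time.\<close>

lemma work_done_mono:
  assumes "\<And>p t. p \<in> {1..P} \<Longrightarrow> t \<in> {t0..t0 + int T} \<Longrightarrow> \<rho> p t \<ge> 0"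
    and "\<And>p t. p \<in> {1..P} \<Longrightarrow> t \<in> {t0..t0 + int T} \<Longrightarrow> u p t \<le> v p t"
  shows "work_done P t0 \<rho> u T \<le> work_done P t0 \<rho> v T"
  unfolding work_done_def using assms
  by (intro sum_mono mult_left_mono) auto

theorem theorem1:
  fixes M :: "'w measure"
    and P :: nat and t0 :: int
    and r :: "nat \<Rightarrow> int \<Rightarrow> 'w \<Rightarrow> real"
    and \<omega> :: 'w
    and ustar u :: "nat \<Rightarrow> int \<Rightarrow> nat"
  assumes "prob_space M"
    and "P \<ge> 1"
    and "\<And>p t. p \<in> {1..P} \<Longrightarrow> t \<ge> t0 \<Longrightarrow> r p t \<in> borel_measurable M"
    and "\<And>p t x. p \<in> {1..P} \<Longrightarrow> t \<ge> t0 \<Longrightarrow> x \<in> space M \<Longrightarrow> r p t x \<ge> 0"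
    and "\<omega> \<in> space M"
    and "binary_states P t0 ustar"
    and "active_throughout P t0 (\<lambda>p t. r p t \<omega>) ustar"
    and "binary_states P t0 u"
  shows "exec_time P t0 (\<lambda>p t. r p t \<omega>) ustar \<le> exec_time P t0 (\<lambda>p t. r p t \<omega>) u"
proof (rule ccontr)
  let ?\<rho> = "\<lambda>p t. r p t \<omega>"
  assume "\<not> ?thesis"
  then have less: "exec_time P t0 ?\<rho> u < exec_time P t0 ?\<rho> ustar"
    by simp
  \<comment> \<open>A value strictly below another \<open>enat\<close> cannot be
    \<open>\<infinity>\<close>, so \<open>u\<close> does finish.\<close>
  then obtain T where T: "exec_time P t0 ?\<rho> u = enat T"
    by (cases "exec_time P t0 ?\<rho> u") auto
  have le: "u p t \<le> ustar p t" if p: "p \<in> {1..P}" and t: "t \<in> {t0..t0 + int T}" for p t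
  proof -
    have "enat (nat (t - t0)) \<le> enat T"
      using t by auto
    \<comment> \<open>The contradiction hypothesis is what brings \<open>t\<close> into the range of
      \<open>active_throughout\<close>; this also covers an \<open>ustar\<close> that never
      finishes.\<close>
    also have "\<dots> \<le> exec_time P t0 ?\<rho> ustar"
      using less T by simp
    finally have "ustar p t = 1"
      using assms(7) p t by (auto simp: active_throughout_def)
    moreover have "u p t \<in> {0, 1}"
      using assms(8) p t by (auto simp: binary_states_def)
    ultimately show ?thesis
      by auto
  qed
  have "1 \<le> work_done P t0 ?\<rho> u T"
    using T by (rule work_done_exec_time)
  also have "\<dots> \<le> work_done P t0 ?\<rho> ustar T"
    using assms(4,5) le by (intro work_done_mono) auto
  finally have "exec_time P t0 ?\<rho> ustar \<le> enat T"
    by (rule exec_time_le)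
  with less T show False
    by simp
qed

end
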